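(* Let $\varepsilon>0$ and let $\mathcal{H}=(V,\mathcal{E})$ be a hypergraph in which every hyperedge $e\in\mathcal{E}$ is equipped with a splitting function $\mathbf{w}_e$ that is submodular and cardinality-based. Then there exists an $\varepsilon$-augmented cut sparsifier $\hat G$ for $\mathcal{H}$ with $O\big(|V|+\frac{1}{\varepsilon}\sum_{e\in\mathcal{E}}\log|e|\big)$ nodes and $O\big(\frac{1}{\varepsilon}\sum_{e\in\mathcal{E}}|e|\log|e|\big)$ edges.
   Context: A hypergraph $\mathcal{H}=(V,\mathcal{E})$ has a finite node set $V$ and a set $\mathcal{E}$ of subsets of $V$ (hyperedges). Each hyperedge $e$ has a splitting function $\mathbf{w}_e:2^e\to\mathbb{R}_{\ge 0}$ which is symmetric ($\mathbf{w}_e(A)=\mathbf{w}_e(e\setminus A)$ for all $A\subseteq e$) and satisfies $\mathbf{w}_e(\emptyset)=0$. It is cardinality-based if $\mathbf{w}_e(A)=\mathbf{w}_e(B)$ whenever $|A|=|B|$, and submodular if $\mathbf{w}_e(A)+\mathbf{w}_e(B)\ge \mathbf{w}_e(A\cap B)+\mathbf{w}_e(A\cup B)$ for all $A,B\subseteq e$. The generalized hypergraph cut function is $\mathbf{cut}_{\mathcal{H}}(S)=\sum_{e\in\mathcal{E}}\mathbf{w}_e(S\cap e)$ for $S\subseteq V$. For a directed graph $\hat G=(V\cup\mathcal{A},\hat E)$ with nonnegative edge weights, where $\mathcal{A}$ is a set of auxiliary nodes disjoint from $V$, let $\mathbf{dircut}_{\hat G}(U)$ be the total weight of edges directed from $U$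 to its complement, and define the augmented cut function $\mathbf{cut}_{\hat G}(S)=\min_{T\subseteq\mathcal{A}}\mathbf{dircut}_{\hat G}(S\cup T)$ for $S\subseteq V$. $\hat G$ is an $\varepsilon$-augmented cut sparsifier for $\mathcal{H}$ if $\mathbf{cut}_{\mathcal{H}}(S)\le \mathbf{cut}_{\hat G}(S)\le(1+\varepsilon)\mathbf{cut}_{\mathcal{H}}(S)$ for every $S\subseteq V$. The implied constants in $O(\cdot)$ are absolute.
   Formalization: In both size bounds the factor 1/ε is replaced by max(1, 1/ε); for ε ≤ 1 nothing changes, while for large ε the stated edge bound with an absolute constant fails already for a single hyperedge {u,v} with w({u}) = w({v}) = 1. *)

theory Defs
  imports Complex_Main "Graph_Theory.Pair_Digraph"
begin

definition hypergraph :: "'a set \<Rightarrow> 'a set set \<Rightarrow> bool" where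
  "hypergraph V E \<longleftrightarrow> finite V \<and> E \<subseteq> Pow V"

text \<open>
  Splitting functions are total on \<open>'a set\<close>; only their values on subsets of the hyperedge matter.
\<close>

definition splitting_function :: "'a set \<Rightarrow> ('a set \<Rightarrow> real) \<Rightarrow> bool" where
  "splitting_function e f \<longleftrightarrow>
     (\<forall>A. A \<subseteq> e \<longrightarrow> 0 \<le> f A) \<and> (\<forall>A. A \<subseteq> e \<longrightarrow> f A = f (e - A)) \<and> f {} = 0"

definition cardinality_based :: "'a set \<Rightarrow> ('a set \<Rightarrow> real) \<Rightarrow> bool" where
  "cardinality_based e f \<longleftrightarrow>
     (\<forall>A B. A \<subseteq> e \<longrightarrow> B \<subseteq> e \<longrightarrow> card A = card B \<longrightarrow> f A = f B)"

definition submodular :: "'a set \<Rightarrow> ('a set \<Rightarrow> real) \<Rightarrow> bool" where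
  "submodular e f \<longleftrightarrow>
     (\<forall>A B. A \<subseteq> e \<longrightarrow> B \<subseteq> e \<longrightarrow> f (A \<inter> B) + f (A \<union> B) \<le> f A + f B)"

definition hyper_cut :: "'a set set \<Rightarrow> ('a set \<Rightarrow> 'a set \<Rightarrow> real) \<Rightarrow> 'a set \<Rightarrow> real" where
  "hyper_cut E w S = (\<Sum>e\<in>E. w e (S \<inter> e))"

definition dircut :: "'n pair_pre_digraph \<Rightarrow> ('n \<times> 'n \<Rightarrow> real) \<Rightarrow> 'n set \<Rightarrow> real" where
  "dircut G c U = (\<Sum>a\<in>{a \<in> parcs G. fst a \<in> U \<and> snd a \<notin> U}. c a)"

text \<open>
  The node set of the augmented graph is the disjoint sum \<open>V <+> A\<close> of the hypergraph's
  nodes and the auxiliary nodes, so \<open>S <+> T\<close> is the union of \<open>S \<subseteq> V\<close> and \<open>T \<subseteq> A\<close>.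
\<close>

definition augmented_cut ::
  "'b set \<Rightarrow> ('a + 'b) pair_pre_digraph \<Rightarrow> (('a + 'b) \<times> ('a + 'b) \<Rightarrow> real) \<Rightarrow> 'a set \<Rightarrow> real" where
  "augmented_cut A G c S = Min ((\<lambda>T. dircut G c (S <+> T)) ` Pow A)"

definition augmented_cut_sparsifier ::
  "real \<Rightarrow> 'a set \<Rightarrow> 'a set set \<Rightarrow> ('a set \<Rightarrow> 'a set \<Rightarrow> real) \<Rightarrow>
   'b set \<Rightarrow> ('a + 'b) pair_pre_digraph \<Rightarrow> (('a + 'b) \<times> ('a + 'b) \<Rightarrow> real) \<Rightarrow> bool" where
  "augmented_cut_sparsifier \<epsilon> V E w A G c \<longleftrightarrow>
     pair_fin_digraph G \<and> pverts G = V <+> A \<and> (\<forall>a\<in>parcs G. 0 \<le> c a) \<and>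
     (\<forall>S. S \<subseteq> V \<longrightarrow>
        hyper_cut E w S \<le> augmented_cut A G c S \<and>
        augmented_cut A G c S \<le> (1 + \<epsilon>) * hyper_cut E w S)"

text \<open>
  In size bounds the factor \<open>1 / \<epsilon>\<close> is read as \<open>max 1 (1 / \<epsilon>)\<close>, which is \<open>1 / \<epsilon>\<close> for \<open>\<epsilon> \<le> 1\<close>.
  With \<open>1 / \<epsilon>\<close> itself and an absolute constant, the edge bound drops below 1 as \<open>\<epsilon>\<close> grows,
  while the single hyperedge \<open>{u, v}\<close> with \<open>w {u} = w {v} = 1\<close> needs an edge for every \<open>\<epsilon>\<close>.
  Empty hyperedges contribute nothing, since \<open>ln 0 = 0\<close>; their splitting function is zero.
\<close>

end

theory Submission
  imports Defs
begin

text \<open>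
  The splitting function of a hyperedge with \<open>n\<close> nodes is a concave symmetric function \<open>g\<close> of the
  cardinality \<open>k\<close>. Summation by parts writes it as \<open>\<Sum>b. c\<^sub>b min k (n - k) b\<close> with the coefficients
  \<open>c\<^sub>b \<ge> 0\<close> given, for \<open>b < n div 2\<close>, by negated second differences and, for \<open>b = n div 2\<close>, by
  the last increment of \<open>g\<close> on the first half. Rounding every threshold \<open>b\<close> up to a power of
  \<open>1 + \<delta>\<close> changes each term by a factor between \<open>1\<close> and \<open>1 + \<delta>\<close> and leaves only
  \<open>O(\<delta>\<^sup>-\<^sup>1 log n)\<close> distinct thresholds. A term \<open>a min k (n - k) b\<close> is realised exactly by
  two auxiliary nodes \<open>p\<close>, \<open>q\<close> with arcs \<open>v \<rightarrow> p\<close> and \<open>q \<rightarrow> v\<close> of weight \<open>a\<close> for all \<open>v\<close> in the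
  hyperedge and an arc \<open>p \<rightarrow> q\<close> of weight \<open>a b\<close>.
\<close>

section \<open>Concave functions as sums of truncations\<close>

text \<open>Passing from \<open>k\<close> to \<open>Suc k\<close> raises \<open>min k b\<close> by 1
  exactly for the \<open>b\<close> above \<open>k\<close>, so the sum grows by the telescoping
  \<open>D (Suc k) - D (Suc r)\<close>, which is the increment of \<open>g\<close>.\<close>

lemma sum_by_parts_min:
  fixes g D :: "nat \<Rightarrow> real"
  assumes g0: "g 0 = 0"
    and D: "\<And>b. b < r \<Longrightarrow> D (Suc b) = g (Suc b) - g b"
    and Dr: "D (Suc r) = 0"
    and k: "k \<le> r"
  shows "g k = (\<Sum>b=1..r. (D b - D (Suc b)) * real (min k b))"
  using k
proof (induction k)
  case 0
  then show ?case using g0 by simp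
next
  case (Suc k)
  have "(\<Sum>b=1..r. (D b - D (Suc b)) * real (min (Suc k) b))
      - (\<Sum>b=1..r. (D b - D (Suc b)) * real (min k b))
      = (\<Sum>b=1..r. if Suc k \<le> b then D b - D (Suc b) else 0)"
    unfolding sum_subtractf[symmetric]
  proof (intro sum.cong refl)
    fix b
    consider "Suc k \<le> b" | "b \<le> k" by linarith
    then show "(D b - D (Suc b)) * real (min (Suc k) b) - (D b - D (Suc b)) * real (min k b)
      = (if Suc k \<le> b then D b - D (Suc b) else 0)"
      by cases (simp_all add: algebra_simps)
  qed
  also have "\<dots> = (\<Sum>b=Suc k..r. D b - D (Suc b))"
    by (rule sum.mono_neutral_cong_right) auto
  also have "\<dots> = - (\<Sum>b=Suc k..r. D (Suc b) - D b)"
    by (simp add: sum_subtractf)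
  also have "(\<Sum>b=Suc k..r. D (Suc b) - D b) = D (Suc r) - D (Suc k)"
    using Suc.prems by (intro sum_Suc_diff) auto
  finally show ?case using Suc D[of k] Dr by simp
qed

text \<open>Symmetry moves every argument to \<open>min k (n - k)\<close>, which lies in the first
  half; there summation by parts applies, with the increments set to 0 beyond
  \<open>n div 2\<close>.\<close>

lemma concave_symmetric_truncations:
  fixes g :: "nat \<Rightarrow> real"
  assumes g0: "g 0 = 0"
    and sym: "\<And>k. k \<le> n \<Longrightarrow> g (n - k) = g k"
    and concave: "\<And>k. Suc (Suc k) \<le> n \<Longrightarrow> g k + g (Suc (Suc k)) \<le> 2 * g (Suc k)"
  obtains c :: "nat \<Rightarrow> real"
  where "\<And>b. b \<in> {1..n div 2} \<Longrightarrow> 0 \<le> c b"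
    and "\<And>k. k \<le> n \<Longrightarrow> g k = (\<Sum>b=1..n div 2. c b * real (min b (min k (n - k))))"
proof
  define r where "r = n div 2"
  define D where "D k = (if k \<le> r then g k - g (k - 1) else 0)" for k
  define c where "c b = D b - D (Suc b)" for b
  show "0 \<le> c b" if bn: "b \<in> {1..n div 2}" for b
  proof -
    obtain k where b: "b = Suc k" using bn by (cases b) auto
    have k: "Suc k \<le> r" using bn b by (simp add: r_def)
    show ?thesis
    proof (cases "Suc k = r")
      case True
      have le: "Suc (Suc k) \<le> n" using k r_def by linarith
      \<comment> \<open>The point after the middle is reflected to \<open>k\<close> (even
        \<open>n\<close>) or \<open>Suc k\<close> (odd \<open>n\<close>). Either way concavity turns
        into \<open>g k \<le> g (Suc k)\<close>, so the last increment is nonnegative.\<close>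
      have "g (Suc (Suc k)) = g (n - Suc (Suc k))" using sym le by simp
      moreover have "n - Suc (Suc k) = k \<or> n - Suc (Suc k) = Suc k"
        using True r_def by linarith
      ultimately show ?thesis using concave[OF le] True
        by (auto simp: c_def D_def b)
    next
      case False
      have "Suc (Suc k) \<le> n" using k r_def by linarith
      with False show ?thesis using concave[of k] k
        by (auto simp: c_def D_def b)
    qed
  qed
  show "g k = (\<Sum>b=1..n div 2. c b * real (min b (min k (n - k))))" if "k \<le> n" for k
  proof -
    have "g k = g (min k (n - k))" using sym[OF that] by (simp add: min_def)
    also have "\<dots> = (\<Sum>b=1..r. (D b - D (Suc b)) * real (min (min k (n - k)) b))"
      by (rule sum_by_parts_min[of g, OF g0]) (auto simp: D_def r_def)
    finally show ?thesis by (simp add: c_def r_def min.commute)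
  qed
qed

section \<open>Rounding thresholds to powers\<close>

text \<open>Turns the number of rounding levels, about \<open>ln n / ln (1 + \<delta>)\<close>, into
  \<open>O(ln n / \<delta>)\<close>.\<close>

lemma ln_one_plus_ge_half:
  fixes \<delta> :: real
  assumes "0 \<le> \<delta>" "\<delta> \<le> 1"
  shows "\<delta> / 2 \<le> ln (1 + \<delta>)"
proof -
  have "exp (\<delta> / 2) \<le> 1 + \<delta> / 2 + (\<delta> / 2)\<^sup>2" using assms by (intro exp_bound) auto
  also have "(\<delta> / 2)\<^sup>2 \<le> \<delta> / 2"
    using assms mult_left_le[of "\<delta> / 2" "\<delta> / 2"] by (simp add: power2_eq_square)
  finally have "exp (\<delta> / 2) \<le> 1 + \<delta>" by simp
  then show ?thesis using assms by (subst ln_ge_iff) auto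
qed

text \<open>By minimality the preceding power lies below \<open>x\<close>, so rounding up costs at
  most one factor \<open>1 + \<delta>\<close>.\<close>

lemma least_power_ge:
  fixes \<delta> x :: real
  assumes "0 < \<delta>" "1 \<le> x"
  defines "j \<equiv> LEAST j. x \<le> (1 + \<delta>) ^ j"
  shows "x \<le> (1 + \<delta>) ^ j" "(1 + \<delta>) ^ j \<le> (1 + \<delta>) * x"
proof -
  obtain m where "x < (1 + \<delta>) ^ m" using real_arch_pow[of "1 + \<delta>" x] assms by auto
  then show "x \<le> (1 + \<delta>) ^ j" unfolding j_def by (rule LeastI[OF less_imp_le])
  show "(1 + \<delta>) ^ j \<le> (1 + \<delta>) * x"
  proof (cases j)
    case 0
    then show ?thesis using assms mult_mono[of 1 "1 + \<delta>" 1 x] by simp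
  next
    case (Suc i)
    then have "\<not> x \<le> (1 + \<delta>) ^ i" 
      using not_less_Least[of i "\<lambda>j. x \<le> (1 + \<delta>) ^ j"] unfolding j_def by auto
    then show ?thesis using Suc assms by simp
  qed
qed

text \<open>Thresholds that round to the same power are merged into one term, whose coefficient
  \<open>\<alpha> j\<close> is the sum of theirs. Rounding up only increases a truncation, so the
  approximation error is one-sided.\<close>

lemma concave_symmetric_geometric_truncations:
  fixes g :: "nat \<Rightarrow> real" and \<delta> :: real
  assumes \<delta>: "0 < \<delta>" "\<delta> \<le> 1" and n: "2 \<le> n"
    and g0: "g 0 = 0"
    and sym: "\<And>k. k \<le> n \<Longrightarrow> g (n - k) = g k"
    and concave: "\<And>k. Suc (Suc k) \<le> n \<Longrightarrow> g k + g (Suc (Suc k)) \<le> 2 * g (Suc k)"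
  obtains J :: nat and \<alpha> :: "nat \<Rightarrow> real"
  where "real (Suc J) \<le> 8 / \<delta> * ln (real n)"
    and "\<And>j. 0 \<le> \<alpha> j"
    and "\<And>k. k \<le> n \<Longrightarrow> g k \<le> (\<Sum>j\<le>J. \<alpha> j * min ((1 + \<delta>) ^ j) (real (min k (n - k))))"
    and "\<And>k. k \<le> n \<Longrightarrow>
      (\<Sum>j\<le>J. \<alpha> j * min ((1 + \<delta>) ^ j) (real (min k (n - k)))) \<le> (1 + \<delta>) * g k"
proof -
  obtain c :: "nat \<Rightarrow> real" where
    c0: "\<And>b. b \<in> {1..n div 2} \<Longrightarrow> 0 \<le> c b" and
    gc: "\<And>k. k \<le> n \<Longrightarrow> g k = (\<Sum>b=1..n div 2. c b * real (min b (min k (n - k))))"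
    using concave_symmetric_truncations[of g n, OF g0 sym concave] by blast
  define lev where "lev x = (LEAST j. x \<le> (1 + \<delta>) ^ j)" for x :: real
  define J where "J = lev (real n)"
  define \<alpha> where "\<alpha> j = sum c {b \<in> {1..n div 2}. lev (real b) = j}" for j
  note lev = least_power_ge[OF \<delta>(1), folded lev_def]
  have lev_le: "lev (real b) \<in> {..J}" if "b \<in> {1..n div 2}" for b
  proof -
    have "real b \<le> real n" using that by (auto intro: order_trans[OF _ div_le_dividend])
    also have "\<dots> \<le> (1 + \<delta>) ^ J" unfolding J_def using lev(1)[of "real n"] n by simp
    finally show ?thesis by (simp add: lev_def Least_le)
  qed
  have regroup: "(\<Sum>j\<le>J. \<alpha> j * F j) = (\<Sum>b=1..n div 2. c b * F (lev (real b)))"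
    for F :: "nat \<Rightarrow> real"
  proof -
    have "(\<Sum>j\<le>J. \<alpha> j * F j)
        = (\<Sum>j\<le>J. \<Sum>b\<in>{b \<in> {1..n div 2}. lev (real b) = j}. c b * F (lev (real b)))"
      unfolding \<alpha>_def sum_distrib_right by (intro sum.cong) auto
    also have "\<dots> = (\<Sum>b=1..n div 2. c b * F (lev (real b)))"
      using lev_le by (intro sum.group) auto
    finally show ?thesis .
  qed
  have "ln 2 \<le> ln (real n)" using n by (subst ln_le_cancel_iff) auto
  then have ln2: "1 / 2 \<le> ln (real n)" using ln_one_plus_ge_half[of 1] by simp
  have lnn: "ln (real n) \<le> 1 / \<delta> * ln (real n)"
    using mult_right_mono[of 1 "1 / \<delta>" "ln (real n)"] ln2 \<delta> by simp
  have J: "real J \<le> 2 + 2 / \<delta> * ln (real n)"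
  proof -
    have "\<delta> / 2 * real J \<le> ln (1 + \<delta>) * real J"
      using ln_one_plus_ge_half[of \<delta>] \<delta> by (intro mult_right_mono) auto
    also have "\<dots> = ln ((1 + \<delta>) ^ J)" using \<delta> by (simp add: ln_realpow)
    also have "\<dots> \<le> ln ((1 + \<delta>) * real n)"
      using lev(2)[of "real n"] n \<delta> by (simp add: J_def)
    also have "\<dots> = ln (1 + \<delta>) + ln (real n)" using n \<delta> by (simp add: ln_mult)
    also have "\<dots> \<le> \<delta> + ln (real n)" using ln_add_one_self_le_self[of \<delta>] \<delta> by simp
    finally show ?thesis using \<delta> by (simp add: field_simps)
  qed
  show thesis
  proof
    show "real (Suc J) \<le> 8 / \<delta> * ln (real n)"
      \<comment> \<open>Here \<open>Suc J\<close> is at most \<open>3 + 2 / \<delta> * ln n\<close>,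
        and \<open>3 \<le> 6 * ln n \<le> 6 / \<delta> * ln n\<close>; hence the 8.\<close>
      using J ln2 lnn by simp
    show "0 \<le> \<alpha> j" for j unfolding \<alpha>_def using c0 by (intro sum_nonneg) auto
    fix k assume k: "k \<le> n"
    define m where "m = min k (n - k)"
    show "g k \<le> (\<Sum>j\<le>J. \<alpha> j * min ((1 + \<delta>) ^ j) (real (min k (n - k))))"
      unfolding regroup gc[OF k] m_def[symmetric]
    proof (intro sum_mono mult_left_mono c0)
      fix b assume "b \<in> {1..n div 2}"
      then show "real (min b m) \<le> min ((1 + \<delta>) ^ lev (real b)) (real m)"
        using lev(1)[of "real b"] by auto
    qed
    show "(\<Sum>j\<le>J. \<alpha> j * min ((1 + \<delta>) ^ j) (real (min k (n - k)))) \<le> (1 + \<delta>) * g k"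
      unfolding regroup gc[OF k] m_def[symmetric] sum_distrib_left mult.left_commute[of "1 + \<delta>"]
    proof (intro sum_mono mult_left_mono c0)
      fix b assume "b \<in> {1..n div 2}"
      \<comment> \<open>If \<open>m\<close> is the smaller argument on both sides, the claim is
        \<open>m \<le> (1 + \<delta>) * m\<close>.\<close>
      moreover have "0 \<le> \<delta> * real m" using \<delta> by simp
      ultimately show "min ((1 + \<delta>) ^ lev (real b)) (real m) \<le> (1 + \<delta>) * real (min b m)"
        using lev(2)[of "real b"] by (auto simp: min_def algebra_simps)
    qed
  qed
qed

section \<open>Splitting functions of a single hyperedge\<close>

lemma splitting_functionD:
  assumes "splitting_function e f"
  shows "A \<subseteq> e \<Longrightarrow> 0 \<le> f A" "A \<subseteq> e \<Longrightarrow> f (e - A) = f A" "f {} = 0"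
  using assms[unfolded splitting_function_def] by (iprover intro: sym)+

text \<open>Concavity is submodularity applied to two sets of size \<open>Suc k\<close> with
  \<open>k\<close> common elements, whose union has size \<open>Suc (Suc k)\<close>. Symmetry is
  complementation in \<open>e\<close>.\<close>

lemma cardinality_based_profile:
  assumes fin: "finite e" and f: "splitting_function e f" "cardinality_based e f" "submodular e f"
  obtains g :: "nat \<Rightarrow> real"
  where "\<And>A. A \<subseteq> e \<Longrightarrow> f A = g (card A)"
    and "g 0 = 0"
    and "\<And>k. k \<le> card e \<Longrightarrow> g (card e - k) = g k"
    and "\<And>k. Suc (Suc k) \<le> card e \<Longrightarrow> g k + g (Suc (Suc k)) \<le> 2 * g (Suc k)"
proof -
  \<comment> \<open>All candidates \<open>B\<close> give the same value; beyond
    \<open>card e\<close> there is none and \<open>g k\<close> is unspecified.\<close>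
  define g where "g k = f (SOME B. B \<subseteq> e \<and> card B = k)" for k
  have g: "f A = g (card A)" if "A \<subseteq> e" for A
  proof -
    have "(SOME B. B \<subseteq> e \<and> card B = card A) \<subseteq> e \<and> card (SOME B. B \<subseteq> e \<and> card B = card A) = card A"
      by (rule someI[of _ A]) (use that in simp)
    then show ?thesis using f(2) that unfolding cardinality_based_def g_def by metis
  qed
  show thesis
  proof
    show "f A = g (card A)" if "A \<subseteq> e" for A using g that .
    show "g 0 = 0" using g[of "{}"] splitting_functionD(3)[OF f(1)] by simp
    show "g (card e - k) = g k" if k: "k \<le> card e" for k
    proof -
      obtain A where A: "A \<subseteq> e" "card A = k" using obtain_subset_with_card_n[OF k] by blast
      then have "f (e - A) = f A" using splitting_functionD(2)[OF f(1)] by simp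
      moreover have "card (e - A) = card e - k" using A fin by (simp add: card_Diff_subset finite_subset)
      ultimately show ?thesis using A g[of A] g[of "e - A"] by auto
    qed
    show "g k + g (Suc (Suc k)) \<le> 2 * g (Suc k)" if k: "Suc (Suc k) \<le> card e" for k
    proof -
      obtain U where U: "U \<subseteq> e" "card U = Suc (Suc k)"
        using obtain_subset_with_card_n[OF k] by blast
      then obtain x B where B: "U = insert x B" "x \<notin> B" "card B = Suc k"
        using card_Suc_eq[of U "Suc k"] by auto
      then obtain y C where C: "B = insert y C" "y \<notin> C" "card C = k"
        using card_Suc_eq[of B k] by auto
      have finC: "finite C" using finite_subset[OF U(1) fin] B(1) C(1) by simp
      have "f (insert x C \<inter> insert y C) + f (insert x C \<union> insert y C)
          \<le> f (insert x C) + f (insert y C)"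
        by (rule f(3)[unfolded submodular_def, rule_format]) (use U(1) B(1) C(1) in auto)
      moreover have "insert x C \<inter> insert y C = C" "insert x C \<union> insert y C = U"
        using B C by auto
      ultimately show ?thesis
        using g[of C] g[of U] g[of "insert x C"] g[of "insert y C"] U B C finC by auto
    qed
  qed
qed

text \<open>The existential form allows \<open>J\<close> and \<open>\<alpha>\<close> to be chosen as
  functions of the hyperedge later.\<close>

lemma splitting_function_geometric_truncations:
  fixes \<delta> :: real
  assumes \<delta>: "0 < \<delta>" "\<delta> \<le> 1" and fin: "finite e" and e: "2 \<le> card e"
    and f: "splitting_function e f" "cardinality_based e f" "submodular e f"
  shows "\<exists>(J :: nat) \<alpha>. real (Suc J) \<le> 8 / \<delta> * ln (real (card e)) \<and> (\<forall>j. 0 \<le> \<alpha> j) \<and>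
    (\<forall>A\<subseteq>e.
      f A \<le> (\<Sum>j\<le>J. \<alpha> j * min ((1 + \<delta>) ^ j) (real (min (card A) (card (e - A))))) \<and>
      (\<Sum>j\<le>J. \<alpha> j * min ((1 + \<delta>) ^ j) (real (min (card A) (card (e - A))))) \<le> (1 + \<delta>) * f A)"
proof -
  obtain g where g: "\<And>A. A \<subseteq> e \<Longrightarrow> f A = g (card A)" "g 0 = 0"
    "\<And>k. k \<le> card e \<Longrightarrow> g (card e - k) = g k"
    "\<And>k. Suc (Suc k) \<le> card e \<Longrightarrow> g k + g (Suc (Suc k)) \<le> 2 * g (Suc k)"
    using cardinality_based_profile[OF fin f] by blast
  obtain J :: nat and \<alpha> where J: "real (Suc J) \<le> 8 / \<delta> * ln (real (card e))" "\<And>j. 0 \<le> \<alpha> j"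
    "\<And>k. k \<le> card e \<Longrightarrow>
      g k \<le> (\<Sum>j\<le>J. \<alpha> j * min ((1 + \<delta>) ^ j) (real (min k (card e - k))))"
    "\<And>k. k \<le> card e \<Longrightarrow>
      (\<Sum>j\<le>J. \<alpha> j * min ((1 + \<delta>) ^ j) (real (min k (card e - k)))) \<le> (1 + \<delta>) * g k"
    using concave_symmetric_geometric_truncations[OF \<delta> e g(2-4)] by blast
  have "card A \<le> card e" "card (e - A) = card e - card A" if "A \<subseteq> e" for A
    using that fin by (auto simp: card_mono card_Diff_subset finite_subset)
  then show ?thesis using J g(1) by (intro exI[of _ J] exI[of _ \<alpha>]) simp
qed

text \<open>Such an \<open>e\<close> has only the subsets \<open>{}\<close> and \<open>e\<close>,
  which symmetry gives equal values. These hyperedges need no gadget.\<close>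

lemma splitting_function_trivial:
  assumes "finite e" "card e < 2" "splitting_function e f" "A \<subseteq> e"
  shows "f A = 0"
proof -
  have "A = {} \<or> A = e"
  proof (rule ccontr)
    assume "\<not> ?thesis"
    then have "A \<subset> e" "A \<noteq> {}" using assms by auto
    then have "card A < card e" "card A \<noteq> 0"
      using assms by (auto intro: psubset_card_mono dest: finite_subset)
    then show False using assms by linarith
  qed
  then show ?thesis using splitting_functionD(2,3)[OF assms(3)] by fastforce
qed

section \<open>The graph of gadgets\<close>

text \<open>The auxiliary nodes \<open>2 * i\<close> and \<open>2 * i + 1\<close> are
  \<open>p\<close> and \<open>q\<close> of gadget \<open>i\<close>.\<close>

definition gadget_arcs :: "'a set \<Rightarrow> nat \<Rightarrow> (('a + nat) \<times> ('a + nat)) set" where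
  "gadget_arcs X i = (\<lambda>v. (Inl v, Inr (2 * i))) ` X \<union> {(Inr (2 * i), Inr (2 * i + 1))} \<union>
     (\<lambda>v. (Inr (2 * i + 1), Inl v)) ` X"

text \<open>Every gadget arc has an auxiliary endpoint \<open>n\<close>, and \<open>n div 2\<close>
  recovers the gadget, so one weight function serves all gadgets. The last clause is a mere
  default.\<close>

fun gadget_weight :: "(nat \<Rightarrow> real) \<Rightarrow> (nat \<Rightarrow> real) \<Rightarrow> ('a + nat) \<times> ('a + nat) \<Rightarrow> real" where
  "gadget_weight a b (Inl v, Inr n) = a (n div 2)"
| "gadget_weight a b (Inr n, Inl v) = a (n div 2)"
| "gadget_weight a b (Inr n, Inr m) = a (n div 2) * b (n div 2)"
| "gadget_weight a b (Inl v, Inl u) = 0"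

lemma finite_gadget_arcs: "finite X \<Longrightarrow> finite (gadget_arcs X i)"
  by (simp add: gadget_arcs_def)

lemma card_gadget_arcs_le:
  assumes "finite X"
  shows "card (gadget_arcs X i) \<le> 2 * card X + 1"
proof -
  have "card (gadget_arcs X i) \<le> card ((\<lambda>v. (Inl v, Inr (2 * i)) :: ('a + nat) \<times> ('a + nat)) ` X)
      + 1 + card ((\<lambda>v. (Inr (2 * i + 1), Inl v) :: ('a + nat) \<times> ('a + nat)) ` X)"
    unfolding gadget_arcs_def by (intro order_trans[OF card_Un_le] add_mono order_refl) simp
  also have "\<dots> \<le> card X + 1 + card X"
    using assms by (intro add_mono card_image_le) auto
  finally show ?thesis by simp
qed

lemma gadget_arcs_disjoint: "i \<noteq> j \<Longrightarrow> gadget_arcs X i \<inter> gadget_arcs Y j = {}"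
  unfolding gadget_arcs_def by auto

lemma gadget_cut:
  fixes X S :: "'a set"
  assumes "finite X"
  shows "sum (gadget_weight a b) {z \<in> gadget_arcs X i. fst z \<in> S <+> T \<and> snd z \<notin> S <+> T} =
    (if 2 * i \<in> T then 0 else a i * card (S \<inter> X)) +
    (if 2 * i \<in> T \<and> 2 * i + 1 \<notin> T then a i * b i else 0) +
    (if 2 * i + 1 \<in> T then a i * card (X - S) else 0)"
proof -
  let ?P = "\<lambda>z :: ('a + nat) \<times> ('a + nat). fst z \<in> S <+> T \<and> snd z \<notin> S <+> T"
  let ?L = "(\<lambda>v. (Inl v, Inr (2 * i)) :: ('a + nat) \<times> ('a + nat)) ` (if 2 * i \<in> T then {} else S \<inter> X)"
  let ?M = "if 2 * i \<in> T \<and> 2 * i + 1 \<notin> T then {(Inr (2 * i), Inr (2 * i + 1)) :: ('a + nat) \<times> ('a + nat)} else {}"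
  let ?R = "(\<lambda>v. (Inr (2 * i + 1), Inl v) :: ('a + nat) \<times> ('a + nat)) ` (if 2 * i + 1 \<in> T then X - S else {})"
  have "{z \<in> gadget_arcs X i. ?P z} = ?L \<union> ?M \<union> ?R"
    unfolding gadget_arcs_def by auto
  moreover have "sum (gadget_weight a b) (?L \<union> ?M \<union> ?R) =
      sum (gadget_weight a b) ?L + sum (gadget_weight a b) ?M + sum (gadget_weight a b) ?R"
    using assms by (subst sum.union_disjoint, (auto split: if_splits)[3])+ (rule refl)
  moreover have "sum (gadget_weight a b) ?L = (if 2 * i \<in> T then 0 else a i * card (S \<inter> X))"
    by (subst sum.reindex) (auto simp: inj_on_def)
  moreover have "sum (gadget_weight a b) ?R = (if 2 * i + 1 \<in> T then a i * card (X - S) else 0)"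
    by (subst sum.reindex) (auto simp: inj_on_def)
  moreover have "sum (gadget_weight a b) ?M = (if 2 * i \<in> T \<and> 2 * i + 1 \<notin> T then a i * b i else 0)"
    by simp
  ultimately show ?thesis by (simp only:)
qed

text \<open>Gadgets share no arcs and no auxiliary nodes, so the minimum of the total cost is the
  sum of the minima of the gadgets. Of the four placements of \<open>p\<close> and \<open>q\<close>,
  three cost one term each; \<open>q\<close> inside and \<open>p\<close> outside pays two terms and
  is never better.\<close>

lemma gadget_graph:
  fixes I :: "nat set" and X :: "nat \<Rightarrow> 'a set" and a b :: "nat \<Rightarrow> real"
  assumes V: "finite V" and I: "finite I" and X: "\<And>i. i \<in> I \<Longrightarrow> X i \<subseteq> V"
    and a: "\<And>i. i \<in> I \<Longrightarrow> 0 \<le> a i" and b: "\<And>i. i \<in> I \<Longrightarrow> 0 \<le> b i"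
  obtains A :: "nat set" and G c
  where "pair_fin_digraph G" "pverts G = V <+> A" "\<forall>z\<in>parcs G. 0 \<le> c z"
    and "card (pverts G) = card V + 2 * card I"
    and "card (parcs G) \<le> (\<Sum>i\<in>I. 2 * card (X i) + 1)"
    and "\<forall>S. augmented_cut A G c S =
      (\<Sum>i\<in>I. a i * min (b i) (real (min (card (S \<inter> X i)) (card (X i - S)))))"
proof -
  define A where "A = (\<lambda>i. 2 * i) ` I \<union> (\<lambda>i. 2 * i + 1) ` I"
  define P where "P i = gadget_arcs (X i) i" for i
  define G where "G = \<lparr>pverts = V <+> A, parcs = \<Union>i\<in>I. P i\<rparr>"
  define c where "c = (gadget_weight a b :: ('a + nat) \<times> ('a + nat) \<Rightarrow> real)"
  have finX: "finite (X i)" if "i \<in> I" for i using X[OF that] V finite_subset by blast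
  have finP: "finite (P i)" if "i \<in> I" for i
    using finX[OF that] by (simp add: P_def finite_gadget_arcs)
  have finA: "finite A" using I by (simp add: A_def)
  have cardA: "card A = 2 * card I"
    unfolding A_def using I by (subst card_Un_disjoint) (auto simp: card_image inj_on_def, presburger)
  show thesis
  proof
    show "pair_fin_digraph G"
    proof
      fix z assume "z \<in> parcs G"
      then show "fst z \<in> pverts G" "snd z \<in> pverts G"
        using subsetD[OF X] by (auto simp: G_def P_def A_def gadget_arcs_def)
    qed (use V I finA finP in \<open>auto simp: G_def\<close>)
    show "pverts G = V <+> A" by (simp add: G_def)
    show "\<forall>z\<in>parcs G. 0 \<le> c z"
      using a b by (auto simp: G_def P_def gadget_arcs_def c_def)
    show "card (pverts G) = card V + 2 * card I"
      using V finA cardA by (simp add: G_def card_Plus)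
    have "card (parcs G) \<le> (\<Sum>i\<in>I. card (P i))"
      unfolding G_def using I by (simp add: card_UN_le)
    also have "\<dots> \<le> (\<Sum>i\<in>I. 2 * card (X i) + 1)"
      unfolding P_def by (intro sum_mono card_gadget_arcs_le finX)
    finally show "card (parcs G) \<le> (\<Sum>i\<in>I. 2 * card (X i) + 1)" .
    show "\<forall>S. augmented_cut A G c S =
      (\<Sum>i\<in>I. a i * min (b i) (real (min (card (S \<inter> X i)) (card (X i - S)))))"
    proof
      fix S :: "'a set"
      define m where "m i = real (min (card (S \<inter> X i)) (card (X i - S)))" for i
      define cost where "cost i T = (if 2 * i \<in> T then 0 else a i * card (S \<inter> X i)) +
        (if 2 * i \<in> T \<and> 2 * i + 1 \<notin> T then a i * b i else 0) +
        (if 2 * i + 1 \<in> T then a i * card (X i - S) else 0)" for i T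
      have dircut: "dircut G c (S <+> T) = (\<Sum>i\<in>I. cost i T)" for T
      proof -
        let ?Q = "\<lambda>z. fst z \<in> S <+> T \<and> snd z \<notin> S <+> T"
        have "{z \<in> parcs G. ?Q z} = (\<Union>i\<in>I. {z \<in> P i. ?Q z})" by (auto simp: G_def)
        then have "dircut G c (S <+> T) = sum c (\<Union>i\<in>I. {z \<in> P i. ?Q z})"
          by (simp add: dircut_def)
        also have "\<dots> = (\<Sum>i\<in>I. sum c {z \<in> P i. ?Q z})"
          using I finP gadget_arcs_disjoint unfolding P_def
          by (intro sum.UNION_disjoint) fastforce+
        also have "\<dots> = (\<Sum>i\<in>I. cost i T)"
          unfolding P_def c_def cost_def using finX by (intro sum.cong gadget_cut) auto
        finally show ?thesis .
      qed
      have lower: "a i * min (b i) (m i) \<le> cost i T" if "i \<in> I" for i T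
      proof -
        \<comment> \<open>The last fact handles \<open>q\<close> inside and \<open>p\<close> outside
          \<open>T\<close>, where the cost has an extra nonnegative summand.\<close>
        have "a i * min (b i) (m i) \<le> a i * b i" "a i * min (b i) (m i) \<le> a i * card (S \<inter> X i)"
          "a i * min (b i) (m i) \<le> a i * card (X i - S)" "0 \<le> a i * card (S \<inter> X i)"
          using a[OF that] by (auto intro!: mult_left_mono simp: m_def)
        then show ?thesis unfolding cost_def by auto
      qed
      \<comment> \<open>In an optimal cut \<open>p = 2 i\<close> leaves \<open>T\<close> if the term \<open>card (S \<inter> X i)\<close> is the smallest of the
        three, and \<open>q = 2 i + 1\<close> joins \<open>T\<close> if \<open>card (X i - S)\<close> is.\<close>
      define T where "T = {n \<in> A. let i = n div 2 in
        if even n then min (b i) (card (X i - S)) \<le> card (S \<inter> X i)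
        else card (X i - S) \<le> min (b i) (card (S \<inter> X i))}"
      have TA: "T \<subseteq> A" by (auto simp: T_def)
      have attained: "cost i T = a i * min (b i) (m i)" if "i \<in> I" for i
      proof -
        have "2 * i \<in> A" "2 * i + 1 \<in> A" using that by (auto simp: A_def)
        \<comment> \<open>The second condition implies the first, so \<open>q\<close> never joins
          \<open>T\<close> without \<open>p\<close>.\<close>
        then have "2 * i \<in> T \<longleftrightarrow> min (b i) (card (X i - S)) \<le> card (S \<inter> X i)"
          "2 * i + 1 \<in> T \<longleftrightarrow> card (X i - S) \<le> min (b i) (card (S \<inter> X i))"
          by (auto simp: T_def Let_def)
        then show ?thesis unfolding cost_def m_def by (auto simp: min_def split: if_splits)
      qed
      have "augmented_cut A G c S = (\<Sum>i\<in>I. a i * min (b i) (m i))"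
        unfolding augmented_cut_def
      proof (rule Min_eqI)
        show "finite ((\<lambda>T. dircut G c (S <+> T)) ` Pow A)" using finA by simp
        show "(\<Sum>i\<in>I. a i * min (b i) (m i)) \<le> y" if "y \<in> (\<lambda>T. dircut G c (S <+> T)) ` Pow A" for y
          using that lower by (auto simp: dircut intro: sum_mono)
        show "(\<Sum>i\<in>I. a i * min (b i) (m i)) \<in> (\<lambda>T. dircut G c (S <+> T)) ` Pow A"
          using TA attained by (intro image_eqI[of _ _ T]) (auto simp: dircut)
      qed
      then show "augmented_cut A G c S =
        (\<Sum>i\<in>I. a i * min (b i) (real (min (card (S \<inter> X i)) (card (X i - S)))))"
        by (simp add: m_def)
    qed
  qed
qed

section \<open>Assembling the gadgets of all hyperedges\<close>

lemma augmented_sparsifier_exists: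
  fixes \<epsilon> :: real and V :: "'a set"
  assumes \<epsilon>: "0 < \<epsilon>" and H: "hypergraph V E"
    and w: "\<And>e. e \<in> E \<Longrightarrow>
      splitting_function e (w e) \<and> cardinality_based e (w e) \<and> submodular e (w e)"
  obtains A :: "nat set" and G c
  where "augmented_cut_sparsifier \<epsilon> V E w A G c"
    and "real (card (pverts G)) \<le>
      card V + 16 * max 1 (1 / \<epsilon>) * (\<Sum>e\<in>E. ln (real (card e)))"
    and "real (card (parcs G)) \<le>
      24 * max 1 (1 / \<epsilon>) * (\<Sum>e\<in>E. real (card e) * ln (real (card e)))"
proof -
  \<comment> \<open>The level count requires \<open>\<delta> \<le> 1\<close>; this cap is where
    \<open>max 1 (1 / \<epsilon>)\<close> comes from.\<close>
  define \<delta> where "\<delta> = min \<epsilon> 1"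
  have \<delta>: "0 < \<delta>" "\<delta> \<le> 1" and inv\<delta>: "max 1 (1 / \<epsilon>) = 1 / \<delta>"
    using \<epsilon> by (auto simp: \<delta>_def min_def max_def field_simps)
  have V: "finite V" and EV: "\<And>e. e \<in> E \<Longrightarrow> e \<subseteq> V" and finE: "finite E"
    using H by (auto simp: hypergraph_def dest: finite_subset)
  have fine: "finite e" if "e \<in> E" for e using EV[OF that] V finite_subset by blast
  \<comment> \<open>A hyperedge with fewer nodes adds 0 to the size bounds, so it may not receive
    any gadget.\<close>
  define E' where "E' = {e \<in> E. 2 \<le> card e}"
  have E': "finite E'" "E' \<subseteq> E" using finE by (auto simp: E'_def)
  define t where "t \<alpha> e j A = \<alpha> j * min ((1 + \<delta>) ^ j) (real (min (card A) (card (e - A))))"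
    for \<alpha> :: "nat \<Rightarrow> real" and e A :: "'a set" and j
  have "\<forall>e\<in>E'. \<exists>J \<alpha>. real (Suc J) \<le> 8 / \<delta> * ln (real (card e)) \<and> (\<forall>j. 0 \<le> \<alpha> j) \<and>
    (\<forall>A\<subseteq>e. w e A \<le> (\<Sum>j\<le>J. t \<alpha> e j A) \<and> (\<Sum>j\<le>J. t \<alpha> e j A) \<le> (1 + \<delta>) * w e A)"
    unfolding t_def
    by (intro ballI splitting_function_geometric_truncations[OF \<delta>]) (auto simp: E'_def fine w)
  then obtain J \<alpha> where J: "\<And>e. e \<in> E' \<Longrightarrow> real (Suc (J e)) \<le> 8 / \<delta> * ln (real (card e))"
    and \<alpha>: "\<And>e j. e \<in> E' \<Longrightarrow> 0 \<le> \<alpha> e j"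
    and lo: "\<And>e A. e \<in> E' \<Longrightarrow> A \<subseteq> e \<Longrightarrow> w e A \<le> (\<Sum>j\<le>J e. t (\<alpha> e) e j A)"
    and up: "\<And>e A. e \<in> E' \<Longrightarrow> A \<subseteq> e \<Longrightarrow> (\<Sum>j\<le>J e. t (\<alpha> e) e j A) \<le> (1 + \<delta>) * w e A"
    by metis
  \<comment> \<open>One gadget per hyperedge and level; \<open>h\<close> numbers them, since gadgets
    are indexed by naturals.\<close>
  define K where "K = Sigma E' (\<lambda>e. {..J e})"
  have finK: "finite K" using E' by (simp add: K_def)
  obtain h where h: "bij_betw h {0..<card K} K" using ex_bij_betw_nat_finite[OF finK] by blast
  have hK: "h i \<in> K" if "i \<in> {0..<card K}" for i using h that by (auto dest: bij_betwE)
  have sumK: "(\<Sum>i=0..<card K. F (h i)) = (\<Sum>e\<in>E'. \<Sum>j\<le>J e. F (e, j))"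
    for F :: "'a set \<times> nat \<Rightarrow> real"
    unfolding sum.reindex_bij_betw[OF h] using E' by (simp add: K_def sum.Sigma)
  define X where "X i = fst (h i)" for i
  define a where "a i = \<alpha> (fst (h i)) (snd (h i))" for i
  define b where "b i = (1 + \<delta>) ^ snd (h i)" for i
  have XV: "X i \<subseteq> V" and a0: "0 \<le> a i" and b0: "0 \<le> b i" if "i \<in> {0..<card K}" for i
    using hK[OF that] EV E' \<alpha> \<delta> by (auto simp: X_def K_def a_def b_def subset_eq)
  obtain A :: "nat set" and G c where
    G: "pair_fin_digraph G" "pverts G = V <+> A" "\<forall>z\<in>parcs G. 0 \<le> c z" and
    nodes: "card (pverts G) = card V + 2 * card {0..<card K}" and
    arcs: "card (parcs G) \<le> (\<Sum>i\<in>{0..<card K}. 2 * card (X i) + 1)" and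
    cut: "\<forall>S. augmented_cut A G c S =
      (\<Sum>i\<in>{0..<card K}. a i * min (b i) (real (min (card (S \<inter> X i)) (card (X i - S)))))"
    by (rule gadget_graph[of V "{0..<card K}" X a b, OF V finite_atLeastLessThan XV a0 b0])
      (assumption | rule that)+
  have cut': "augmented_cut A G c S = (\<Sum>e\<in>E'. \<Sum>j\<le>J e. t (\<alpha> e) e j (S \<inter> e))" for S
  proof -
    have "e - S \<inter> e = e - S" for e by auto
    then show ?thesis
      using sumK[of "\<lambda>p. t (\<alpha> (fst p)) (fst p) (snd p) (S \<inter> fst p)"]
      unfolding cut[rule_format] a_def b_def X_def by (simp add: t_def)
  qed
  have hcut: "hyper_cut E w S = (\<Sum>e\<in>E'. w e (S \<inter> e))" for S
    unfolding hyper_cut_def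
  proof (intro sum.mono_neutral_right ballI finE E')
    fix e assume "e \<in> E - E'"
    then show "w e (S \<inter> e) = 0"
      using fine w by (intro splitting_function_trivial[of e]) (auto simp: E'_def)
  qed
  have hcut0: "0 \<le> hyper_cut E w S" for S
    unfolding hyper_cut_def using w by (intro sum_nonneg splitting_functionD(1)) auto
  \<comment> \<open>Cardinality 0 is covered by \<open>ln 0 = 0\<close>.\<close>
  have ln0: "0 \<le> ln (real (card e))" for e :: "'a set"
    by (cases "card e") auto
  show thesis
  proof
    show "augmented_cut_sparsifier \<epsilon> V E w A G c"
      unfolding augmented_cut_sparsifier_def
    proof (intro conjI allI impI G)
      fix S
      show "hyper_cut E w S \<le> augmented_cut A G c S"
        unfolding hcut cut' by (intro sum_mono lo) auto
      have "augmented_cut A G c S \<le> (1 + \<delta>) * hyper_cut E w S"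
        unfolding hcut cut' sum_distrib_left by (intro sum_mono up) auto
      also have "\<dots> \<le> (1 + \<epsilon>) * hyper_cut E w S"
        using hcut0 by (intro mult_right_mono) (auto simp: \<delta>_def)
      finally show "augmented_cut A G c S \<le> (1 + \<epsilon>) * hyper_cut E w S" .
    qed
    have "real (card K) = (\<Sum>e\<in>E'. real (Suc (J e)))"
      using sumK[of "\<lambda>_. 1"] by simp
    also have "\<dots> \<le> (\<Sum>e\<in>E'. 8 / \<delta> * ln (real (card e)))" by (intro sum_mono J)
    also have "\<dots> \<le> (\<Sum>e\<in>E. 8 / \<delta> * ln (real (card e)))"
      using finE E' ln0 \<delta> by (intro sum_mono2) auto
    also have "\<dots> = 8 / \<delta> * (\<Sum>e\<in>E. ln (real (card e)))"
      by (rule sum_distrib_left[symmetric])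
    finally have "2 * real (card K) \<le> 16 * (1 / \<delta>) * (\<Sum>e\<in>E. ln (real (card e)))"
      by simp
    then show "real (card (pverts G)) \<le>
      card V + 16 * max 1 (1 / \<epsilon>) * (\<Sum>e\<in>E. ln (real (card e)))"
      unfolding inv\<delta> nodes by simp
    have "real (card (parcs G)) \<le> (\<Sum>i=0..<card K. 2 * real (card (X i)) + 1)"
      using of_nat_mono[OF arcs, where 'a = real] by (simp add: add.commute)
    also have "\<dots> = (\<Sum>e\<in>E'. real (Suc (J e)) * (2 * real (card e) + 1))"
      unfolding X_def sumK[of "\<lambda>p. 2 * real (card (fst p)) + 1"] by simp
    \<comment> \<open>A gadget on \<open>e\<close> has at most
      \<open>2 * card e + 1 \<le> 3 * card e\<close> arcs, whence 24 = 8 * 3.\<close>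
    also have "\<dots> \<le> (\<Sum>e\<in>E'. (8 / \<delta> * ln (real (card e))) * (3 * real (card e)))"
      using ln0 \<delta> by (intro sum_mono mult_mono J) (auto simp: E'_def)
    also have "\<dots> \<le> (\<Sum>e\<in>E. (8 / \<delta> * ln (real (card e))) * (3 * real (card e)))"
      using finE E' ln0 \<delta> by (intro sum_mono2) auto
    also have "\<dots> = 24 * (1 / \<delta>) * (\<Sum>e\<in>E. real (card e) * ln (real (card e)))"
      unfolding sum_distrib_left by (intro sum.cong) auto
    finally show "real (card (parcs G)) \<le>
      24 * max 1 (1 / \<epsilon>) * (\<Sum>e\<in>E. real (card e) * ln (real (card e)))"
      unfolding inv\<delta> .
  qed
qed

theorem theorem1:
  shows "\<exists>C>0. \<forall>\<epsilon>>0. \<forall>(V :: 'a set) E w.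
    hypergraph V E \<longrightarrow>
    (\<forall>e\<in>E. splitting_function e (w e) \<and> cardinality_based e (w e) \<and> submodular e (w e)) \<longrightarrow>
    (\<exists>(A :: nat set) G c.
       augmented_cut_sparsifier \<epsilon> V E w A G c \<and>
       real (card (pverts G)) \<le>
         C * (real (card V) + max 1 (1 / \<epsilon>) * (\<Sum>e\<in>E. ln (real (card e)))) \<and>
       real (card (parcs G)) \<le>
         C * (max 1 (1 / \<epsilon>) * (\<Sum>e\<in>E. real (card e) * ln (real (card e)))))"
proof (intro exI[of _ 24] conjI allI impI)
  fix \<epsilon> :: real and V :: "'a set" and E w
  assume \<epsilon>: "0 < \<epsilon>" and H: "hypergraph V E" and w: "\<forall>e\<in>E.
    splitting_function e (w e) \<and> cardinality_based e (w e) \<and> submodular e (w e)"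
  obtain A :: "nat set" and G c where 1: "augmented_cut_sparsifier \<epsilon> V E w A G c"
    and 2: "real (card (pverts G)) \<le>
      card V + 16 * max 1 (1 / \<epsilon>) * (\<Sum>e\<in>E. ln (real (card e)))"
    and 3: "real (card (parcs G)) \<le>
      24 * max 1 (1 / \<epsilon>) * (\<Sum>e\<in>E. real (card e) * ln (real (card e)))"
    using augmented_sparsifier_exists[OF \<epsilon> H] w by blast
  \<comment> \<open>Raising the node constant from 16 to the common 24 needs a nonnegative
    logarithmic sum.\<close>
  have "0 \<le> ln (real (card e))" for e :: "'a set" by (cases "card e") auto
  then have "0 \<le> max 1 (1 / \<epsilon>) * (\<Sum>e\<in>E. ln (real (card e)))"
    by (intro mult_nonneg_nonneg sum_nonneg) auto
  with 1 2 3 show "\<exists>(A :: nat set) G c.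
       augmented_cut_sparsifier \<epsilon> V E w A G c \<and>
       real (card (pverts G)) \<le>
         24 * (real (card V) + max 1 (1 / \<epsilon>) * (\<Sum>e\<in>E. ln (real (card e)))) \<and>
       real (card (parcs G)) \<le>
         24 * (max 1 (1 / \<epsilon>) * (\<Sum>e\<in>E. real (card e) * ln (real (card e))))"
    by (intro exI[of _ A] exI[of _ G] exI[of _ c]) auto
qed simp

end
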